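(* Let $\mathcal{G}$ be a hereditary graph class. The following are equivalent: (i) $\mathcal{G}$ has strongly sublinear separation-number; (ii) $\mathcal{G}$ has strongly sublinear tree-partition-width; (iii) $\mathcal{G}$ has strongly sublinear star-partition-width.
   Context: Graphs are simple and finite. A graph class is hereditary if it is closed under isomorphism and under taking induced subgraphs. A balanced separator in an $n$-vertex graph $G$ is a set $S\subseteq V(G)$ such that each component of $G-S$ has at most $n/2$ vertices; the separation-number $\mathrm{sep}(G)$ is the minimum size of a balanced separator. For graphs $H,G$, an $H$-partition of $G$ is a partition $(V_x:x\in V(H))$ of $V(G)$ indexed by $V(H)$ (parts may be empty) such that for every edge $vw\in E(G)$ with $v\in V_x$, $w\in V_y$, either $x=y$ or $xy\in E(H)$; its width is the maximum size of a part. The tree-partition-width $\mathrm{tpw}(G)$ is the minimum width of an $H$-partition of $G$ with $H$ a tree; the star-partition-width $\mathrm{spw}(G)$ is the minimum width of an $H$-partition of $G$ with $H$ a star. For a graph parameter $f$ and class $\mathcal{G}$, $f(\mathcal{G})$ denotes the function $n\mapsto\max\{f(G):G\in\mathcal{G},|V(G)|=n\}$, and $\mathcal{G}$ has strongly sublinear $f$ if $f(\mathcal{G})\in O(n^{1-\epsilon})$ for some fixed $\epsilon>0$. *)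

theory Defs
  imports
    Complex_Main
    "HOL-Library.Disjoint_Sets"
    "HOL-Library.Landau_Symbols"
    "Graph_Theory.Graph_Theory"
begin

text \<open>
  Finite simple graphs are modelled by the locale \<open>pair_graph\<close>: finite symmetric loop-free
  digraphs, in which an edge \<open>vw\<close> is the pair of arcs \<open>(v, w)\<close>, \<open>(w, v)\<close>.
\<close>

text \<open>
  A graph class is a set of graphs on an arbitrary but fixed vertex type, and closure under
  isomorphism is closure within that type. Over an infinite type such as \<open>nat\<close> every finite graph
  has an isomorphic copy, so these are the graph classes in the usual sense.
\<close>

definition hereditary :: "'a pair_pre_digraph set \<Rightarrow> bool" where
  "hereditary \<G> \<longleftrightarrow>
     (\<forall>G\<in>\<G>. \<forall>H. digraph_iso (with_proj G) (with_proj H) \<longrightarrow> H \<in> \<G>) \<and>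
     (\<forall>G\<in>\<G>. \<forall>H. induced_subgraph (with_proj H) (with_proj G) \<longrightarrow> H \<in> \<G>)"

text \<open>
  As arcs come in opposite pairs, strong components are the connected components.
\<close>

definition balanced_separator :: "'a pair_pre_digraph \<Rightarrow> 'a set \<Rightarrow> bool" where
  "balanced_separator G S \<longleftrightarrow>
     S \<subseteq> pverts G \<and>
     (\<forall>C \<in> pre_digraph.sccs_verts (with_proj G \<restriction> (pverts G - S)).
        real (card C) \<le> real (card (pverts G)) / 2)"

definition separation_number :: "'a pair_pre_digraph \<Rightarrow> nat" where
  "separation_number G = (LEAST k. \<exists>S. balanced_separator G S \<and> card S = k)"

text \<open>
  The constant \<open>tree\<close> of \<open>Digraph_Component\<close> is unsuitable here: \<open>cycle\<close> also counts the closed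
  walk \<open>v, w, v\<close> along an edge. In a simple graph the cycles are those of length at least 3.
\<close>

definition is_tree :: "'a pair_pre_digraph \<Rightarrow> bool" where
  "is_tree T \<longleftrightarrow>
     pair_graph T \<and> Digraph_Component.connected (with_proj T) \<and>
     \<not> (\<exists>p. pre_digraph.cycle (with_proj T) p \<and> 3 \<le> length p)"

definition is_star :: "'a pair_pre_digraph \<Rightarrow> bool" where
  "is_star T \<longleftrightarrow>
     pair_graph T \<and>
     (\<exists>c\<in>pverts T. parcs T = {c} \<times> (pverts T - {c}) \<union> (pverts T - {c}) \<times> {c})"

definition graph_partition ::
  "'b pair_pre_digraph \<Rightarrow> 'a pair_pre_digraph \<Rightarrow> ('b \<Rightarrow> 'a set) \<Rightarrow> bool" where
  "graph_partition H G P \<longleftrightarrow>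
     (\<Union>x\<in>pverts H. P x) = pverts G \<and>
     disjoint_family_on P (pverts H) \<and>
     (\<forall>(v, w) \<in> parcs G. \<forall>x\<in>pverts H. \<forall>y\<in>pverts H.
        v \<in> P x \<and> w \<in> P y \<longrightarrow> x = y \<or> (x, y) \<in> parcs H)"

definition partition_width :: "'b pair_pre_digraph \<Rightarrow> ('b \<Rightarrow> 'a set) \<Rightarrow> nat" where
  "partition_width H P = Max ((\<lambda>x. card (P x)) ` pverts H)"

text \<open>
  Index graphs are taken on \<open>nat\<close>, where every finite tree has an isomorphic copy.
  The minima exist, because the one-vertex graph is both a tree and a star.
\<close>

definition tree_partition_width :: "'a pair_pre_digraph \<Rightarrow> nat" where
  "tree_partition_width G =
     (LEAST w. \<exists>(H :: nat pair_pre_digraph) P.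
        is_tree H \<and> graph_partition H G P \<and> partition_width H P = w)"

definition star_partition_width :: "'a pair_pre_digraph \<Rightarrow> nat" where
  "star_partition_width G =
     (LEAST w. \<exists>(H :: nat pair_pre_digraph) P.
        is_star H \<and> graph_partition H G P \<and> partition_width H P = w)"

text \<open>
  On \<open>nat\<close>, \<open>Sup\<close> is the maximum of a nonempty finite set, and \<open>Sup {} = 0\<close>. The set below is
  finite for the three parameters above, as none exceeds the number of vertices; it is empty
  if the class has no graph on \<open>n\<close> vertices.
\<close>

definition class_parameter ::
  "('a pair_pre_digraph \<Rightarrow> nat) \<Rightarrow> 'a pair_pre_digraph set \<Rightarrow> nat \<Rightarrow> nat" where
  "class_parameter f \<G> n = Sup {f G | G. G \<in> \<G> \<and> card (pverts G) = n}"

definition strongly_sublinear ::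
  "('a pair_pre_digraph \<Rightarrow> nat) \<Rightarrow> 'a pair_pre_digraph set \<Rightarrow> bool" where
  "strongly_sublinear f \<G> \<longleftrightarrow>
     (\<exists>\<epsilon>>0. (\<lambda>n. real (class_parameter f \<G> n)) \<in> O(\<lambda>n. real n powr (1 - \<epsilon>)))"

end

theory Submission
  imports Defs
begin

text \<open>
  A star is a tree, and some part of any tree-partition is a balanced separator, so the three
  parameters are pointwise ordered. Conversely, if separators have size \<open>O(n\<^sup>1\<^sup>-\<^sup>\<epsilon>)\<close>, recursive
  separation deletes \<open>O(n p\<^sup>-\<^sup>\<epsilon>)\<close> vertices to leave components with at most \<open>p\<close> vertices. The
  deleted vertices form the centre of a star-partition whose leaves are the components, and
  \<open>p = n\<^sup>1\<^sup>/\<^sup>(\<^sup>1\<^sup>+\<^sup>\<epsilon>\<^sup>)\<close> balances the two sizes.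
\<close>

section \<open>Induced subgraphs and components\<close>

text \<open>An induced subgraph has to be a \<open>pair_pre_digraph\<close> again in order to be a
  member of \<open>\<G>\<close>, which \<open>with_proj G \<restriction> X\<close> is not.\<close>

definition pinduce :: "'a pair_pre_digraph \<Rightarrow> 'a set \<Rightarrow> 'a pair_pre_digraph" where
  "pinduce G X = \<lparr>pverts = X, parcs = parcs G \<inter> X \<times> X\<rparr>"

lemma pinduce_simps [simp]:
  "pverts (pinduce G X) = X" "parcs (pinduce G X) = parcs G \<inter> X \<times> X"
  by (simp_all add: pinduce_def)

lemma induce_subgraph_with_proj: "with_proj G \<restriction> X = with_proj (pinduce G X)"
  by (auto simp: induce_subgraph_def with_proj_def)

lemma pair_graph_iff:
  "pair_graph G \<longleftrightarrow> finite (pverts G) \<and> parcs G \<subseteq> pverts G \<times> pverts G \<and> sym (parcs G) \<and> irrefl (parcs G)"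
proof
  assume "pair_graph G"
  then interpret pair_graph G .
  show "finite (pverts G) \<and> parcs G \<subseteq> pverts G \<times> pverts G \<and> sym (parcs G) \<and> irrefl (parcs G)"
    by (auto simp: irrefl_def sym_def dest: in_arcsD1 in_arcsD2 no_loops' arcs_symmetric)
next
  assume *: "finite (pverts G) \<and> parcs G \<subseteq> pverts G \<times> pverts G \<and> sym (parcs G) \<and> irrefl (parcs G)"
  then have "finite (parcs G)"
    by (auto intro: finite_subset)
  with * show "pair_graph G"
    by unfold_locales (auto simp: irrefl_def symmetric_def)
qed

lemma pair_graph_pinduce:
  assumes "pair_graph G" "X \<subseteq> pverts G"
  shows "pair_graph (pinduce G X)"
  using assms by (auto simp: pair_graph_iff sym_def irrefl_def intro: finite_subset)

lemma hereditary_pinduce: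
  assumes "hereditary \<G>" "G \<in> \<G>" "pair_graph G" "X \<subseteq> pverts G"
  shows "pinduce G X \<in> \<G>"
proof -
  interpret G: pair_graph G by fact
  interpret H: pair_graph "pinduce G X" using assms by (intro pair_graph_pinduce)
  have "induced_subgraph (with_proj (pinduce G X)) (with_proj G)"
    using assms(4) G.wf_digraph_axioms H.wf_digraph_axioms
    by (auto simp: induced_subgraph_def subgraph_def)
  with assms show ?thesis unfolding hereditary_def by blast
qed

abbreviation components :: "'a pair_pre_digraph \<Rightarrow> 'a set set" where
  "components G \<equiv> pre_digraph.sccs_verts (with_proj G)"

lemma partition_on_components:
  assumes "pair_graph G"
  shows "partition_on (pverts G) (components G)"
proof -
  interpret pair_graph G by fact
  show ?thesis
  proof (rule partition_onI)
    show "\<Union>(components G) = pverts G"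
      using sccs_verts_subsets scc_of_in_sccs_verts in_scc_of_self by blast
    show "disjnt C D" if "C \<in> components G" "D \<in> components G" "C \<noteq> D" for C D
      using sccs_verts_disjoint[OF that] by (simp add: disjnt_def)
    show "{} \<notin> components G"
      unfolding in_sccs_verts_conv_reachable by blast
  qed
qed

text \<open>The reverse arc makes \<open>u\<close> and \<open>v\<close> reachable from each other,
  so they share a strong component.\<close>

lemma component_arc_closed:
  assumes "pair_graph G" "C \<in> components G" "u \<in> C" "(u, v) \<in> parcs G"
  shows "v \<in> C"
proof -
  interpret pair_graph G by fact
  show ?thesis
    using assms(2-4) arcs_symmetric[OF assms(4)]
    unfolding in_sccs_verts_conv_reachable by (meson reachable_adjI)
qed

text \<open>The parts need not be connected: each is a union of components of \<open>G - S\<close>.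
  A graph that is already small thus counts as a single part.\<close>

definition fragmentation :: "'a pair_pre_digraph \<Rightarrow> 'a set \<Rightarrow> 'a set set \<Rightarrow> bool" where
  "fragmentation G S \<P> \<longleftrightarrow> S \<subseteq> pverts G \<and> partition_on (pverts G - S) \<P> \<and>
     (\<forall>(v, w) \<in> parcs G. \<forall>X\<in>\<P>. v \<in> X \<longrightarrow> w \<in> X \<union> S)"

lemma fragmentation_finite:
  assumes "pair_graph G" "fragmentation G S \<P>"
  shows "finite \<P>" "X \<in> \<P> \<Longrightarrow> finite X"
  using assms finite_elements[of "pverts G - S" \<P>]
  by (auto simp: fragmentation_def pair_graph_iff partition_on_def intro: finite_subset)

lemma fragmentation_components:
  assumes "pair_graph G" "S \<subseteq> pverts G"
  shows "fragmentation G S (components (pinduce G (pverts G - S)))"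
proof -
  let ?H = "pinduce G (pverts G - S)"
  have H: "pair_graph ?H" using assms by (intro pair_graph_pinduce) auto
  have p: "partition_on (pverts G - S) (components ?H)"
    using partition_on_components[OF H] by simp
  have "w \<in> X \<union> S" if "(v, w) \<in> parcs G" "X \<in> components ?H" "v \<in> X" for v w X
  proof (cases "w \<in> S")
    case False
    have "v \<in> pverts G - S" using that p by (auto simp: partition_on_def)
    moreover have "w \<in> pverts G" using that assms by (auto simp: pair_graph_iff)
    ultimately show ?thesis
      using component_arc_closed[OF H that(2,3), of w] that(1) False by auto
  qed auto
  with p assms(2) show ?thesis unfolding fragmentation_def by blast
qed

text \<open>An arc leaving \<open>Y \<in> \<Q> X\<close> either ends in \<open>S\<close> or stays
  inside \<open>X\<close>; in the latter case it is an arc of \<open>pinduce G X\<close> and ends in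
  \<open>Y\<close> or \<open>T X\<close>.\<close>

lemma fragmentation_refine:
  assumes G: "fragmentation G S \<C>"
    and C: "\<And>X. X \<in> \<C> \<Longrightarrow> fragmentation (pinduce G X) (T X) (\<Q> X)"
  shows "fragmentation G (S \<union> (\<Union>X\<in>\<C>. T X)) (\<Union>X\<in>\<C>. \<Q> X)"
proof -
  let ?S = "S \<union> (\<Union>X\<in>\<C>. T X)" and ?P = "\<Union>X\<in>\<C>. \<Q> X"
  have S: "S \<subseteq> pverts G" "\<Union>\<C> = pverts G - S" and dC: "disjoint \<C>"
    and arcC: "\<And>v w X. \<lbrakk>(v, w) \<in> parcs G; X \<in> \<C>; v \<in> X\<rbrakk> \<Longrightarrow> w \<in> X \<union> S"
    using G by (auto simp: fragmentation_def partition_on_def)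
  have T: "T X \<subseteq> X" "\<Union>(\<Q> X) = X - T X" "disjoint (\<Q> X)" "{} \<notin> \<Q> X" if "X \<in> \<C>" for X
    using C[OF that] by (auto simp: fragmentation_def partition_on_def)
  have arcQ: "w \<in> Y \<union> T X" if "X \<in> \<C>" "Y \<in> \<Q> X" "v \<in> Y" "(v, w) \<in> parcs G" "w \<in> X" for v w X Y
  proof -
    have "v \<in> X" using T(2)[OF that(1)] that by blast
    then have "(v, w) \<in> parcs (pinduce G X)" using that by simp
    then show ?thesis using C[OF that(1)] that unfolding fragmentation_def by blast
  qed
  have "\<Union>?P = (\<Union>X\<in>\<C>. X - T X)" using T(2) by blast
  also have "\<dots> = pverts G - ?S"
  proof -
    \<comment> \<open>Distinct parts are disjoint, so deleting all the sets \<open>T Y\<close> from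
      \<open>X\<close> deletes no more than \<open>T X\<close>.\<close>
    have "X \<inter> T Y \<subseteq> T X" if "X \<in> \<C>" "Y \<in> \<C>" for X Y
      using that dC T(1)[OF that(2)] by (cases "X = Y") (auto simp: disjoint_def)
    then have "X - T X = X - (\<Union>Y\<in>\<C>. T Y)" if "X \<in> \<C>" for X
      using that by blast
    then have "(\<Union>X\<in>\<C>. X - T X) = \<Union>\<C> - (\<Union>Y\<in>\<C>. T Y)" by auto
    then show ?thesis unfolding S(2) by blast
  qed
  finally have U: "\<Union>?P = pverts G - ?S" .
  have "Y \<inter> Y' = {}" if "X \<in> \<C>" "X' \<in> \<C>" "Y \<in> \<Q> X" "Y' \<in> \<Q> X'" "Y \<noteq> Y'" for X X' Y Y'
  proof (cases "X = X'")
    case True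
    then show ?thesis using that T(3)[OF that(1)] by (auto simp: disjoint_def)
  next
    case False
    then have "X \<inter> X' = {}" using that dC by (auto simp: disjoint_def)
    then show ?thesis using T(2)[OF that(1)] T(2)[OF that(2)] that by blast
  qed
  then have d: "disjoint ?P" by (auto simp: disjoint_def)
  have "w \<in> Y \<union> ?S" if "(v, w) \<in> parcs G" "X \<in> \<C>" "Y \<in> \<Q> X" "v \<in> Y" for v w X Y
  proof -
    have "v \<in> X" using T(2)[OF that(2)] that by blast
    then have "w \<in> X \<union> S" using arcC that by blast
    then show ?thesis using arcQ[OF that(2,3,4,1)] that(2) by blast
  qed
  moreover have "?S \<subseteq> pverts G" using S T(1) by blast
  moreover have "{} \<notin> ?P" using T(4) by blast
  ultimately show ?thesis
    using U d unfolding fragmentation_def partition_on_def by blast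
qed

section \<open>Minimal separators and partitions\<close>

lemma balanced_separator_iff:
  "balanced_separator G S \<longleftrightarrow> S \<subseteq> pverts G \<and>
     (\<forall>C \<in> components (pinduce G (pverts G - S)). real (card C) \<le> real (card (pverts G)) / 2)"
  by (simp add: balanced_separator_def induce_subgraph_with_proj)

text \<open>Deleting all vertices leaves no component, so a balanced separator exists and
  \<open>LEAST\<close> is attained.\<close>

lemma separation_number_attained:
  assumes "pair_graph G"
  obtains S where "balanced_separator G S" "card S = separation_number G"
proof -
  have "components (pinduce G {}) = {}"
    using partition_on_components[OF pair_graph_pinduce[OF assms empty_subsetI]]
    by (simp add: partition_on_empty)
  then have "balanced_separator G (pverts G)"
    by (simp add: balanced_separator_iff)
  then have "\<exists>k S. balanced_separator G S \<and> card S = k"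
    by blast
  then have "\<exists>S. balanced_separator G S \<and> card S = separation_number G"
    unfolding separation_number_def by (rule LeastI_ex)
  with that show thesis by blast
qed

lemma separation_number_le: "balanced_separator G S \<Longrightarrow> separation_number G \<le> card S"
  unfolding separation_number_def by (rule Least_le) blast

text \<open>Node 0 is the centre and carries \<open>S\<close>; the nodes from 1 on are leaves, one
  for each part. The second conclusion is what makes the \<open>LEAST\<close> in the width
  definitions attained.\<close>

lemma star_partition_width_le:
  assumes G: "pair_graph G" and frag: "fragmentation G S \<P>"
    and "card S \<le> k" "\<And>X. X \<in> \<P> \<Longrightarrow> card X \<le> k"
  shows "star_partition_width G \<le> k"
    and "\<exists>(H :: nat pair_pre_digraph) P. is_star H \<and> graph_partition H G P"
proof -
  obtain h where h: "bij_betw h {0..<card \<P>} \<P>"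
    using ex_bij_betw_nat_finite fragmentation_finite(1)[OF G frag] by blast
  define V where "V = insert 0 (Suc ` {0..<card \<P>})"
  define H where "H = \<lparr>pverts = V, parcs = {0} \<times> (V - {0}) \<union> (V - {0}) \<times> {0}\<rparr>"
  define P where "P = case_nat S h"
  have hP: "h i \<in> \<P>" if "i < card \<P>" for i
    using h that by (auto simp: bij_betw_def)
  have V: "finite V" "0 \<in> V" by (simp_all add: V_def)
  have star: "is_star H"
    unfolding is_star_def using V
    by (auto simp: pair_graph_iff H_def sym_def irrefl_def intro!: bexI[of _ 0])
  have "(\<Union>x\<in>V. P x) = S \<union> \<Union>(h ` {0..<card \<P>})"
    unfolding V_def P_def by (simp add: image_image del: image_Suc_atLeastLessThan)
  then have "(\<Union>x\<in>V. P x) = S \<union> \<Union>\<P>"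
    using h by (simp add: bij_betw_def)
  then have cover: "(\<Union>x\<in>V. P x) = pverts G"
    using frag by (auto simp: fragmentation_def partition_on_def)
  have "h i \<inter> h j = {}" if "i < card \<P>" "j < card \<P>" "i \<noteq> j" for i j
  proof -
    have "h i \<noteq> h j" using h that by (auto simp: bij_betw_def inj_on_def)
    with hP that frag show ?thesis
      by (auto simp: fragmentation_def partition_on_def disjoint_def)
  qed
  moreover have "S \<inter> h i = {}" if "i < card \<P>" for i
    using hP[OF that] frag by (auto simp: fragmentation_def partition_on_def)
  ultimately have disj: "disjoint_family_on P V"
    by (fastforce simp: disjoint_family_on_def V_def P_def split: nat.splits)
  have "x = y \<or> (x, y) \<in> parcs H"
    if vw: "(v, w) \<in> parcs G" "x \<in> V" "y \<in> V" "v \<in> P x" "w \<in> P y" for v w x y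
  proof (cases "x = 0 \<or> y = 0")
    case True
    then show ?thesis using vw by (auto simp: H_def)
  next
    case False
    then obtain i where i: "x = Suc i" "i < card \<P>"
      using vw by (cases x) (auto simp: V_def)
    \<comment> \<open>Between two leaves: \<open>w\<close> lies in \<open>P x\<close> or in the
      centre, but also in \<open>P y\<close> with \<open>y \<noteq> 0\<close>, so disjointness
      leaves only \<open>x = y\<close>.\<close>
    have "w \<in> h i \<union> S"
      using frag hP[OF i(2)] vw i by (auto simp: fragmentation_def P_def)
    then have "w \<in> P x \<or> w \<in> P 0" by (auto simp: P_def i)
    then show ?thesis
      using disj vw False V by (auto simp: disjoint_family_on_def)
  qed
  then have part: "graph_partition H G P"
    using cover disj by (auto simp: graph_partition_def H_def)
  show "\<exists>(H :: nat pair_pre_digraph) P. is_star H \<and> graph_partition H G P"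
    using star part by blast
  have "partition_width H P \<le> k"
    unfolding partition_width_def using V assms(3,4) hP
    by (auto simp: H_def V_def P_def simp del: image_Suc_atLeastLessThan)
  moreover have "star_partition_width G \<le> partition_width H P"
    unfolding star_partition_width_def using star part by (intro Least_le) blast
  ultimately show "star_partition_width G \<le> k" by simp
qed

lemma star_partition_width_le_card:
  assumes "pair_graph G"
  shows "star_partition_width G \<le> card (pverts G)"
    and "\<exists>(H :: nat pair_pre_digraph) P. is_star H \<and> graph_partition H G P"
proof -
  have "fragmentation G (pverts G) {}"
    by (auto simp: fragmentation_def partition_on_def)
  from star_partition_width_le[OF assms this order_refl]
  show "star_partition_width G \<le> card (pverts G)"
    and "\<exists>(H :: nat pair_pre_digraph) P. is_star H \<and> graph_partition H G P"
    by auto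
qed

section \<open>Stars and trees\<close>

text \<open>Connectedness is strong connectedness of the symmetric closure, and a symmetric arc set
  is its own closure.\<close>

lemma connected_pair_graph_iff:
  assumes "pair_graph T"
  shows "Digraph_Component.connected (with_proj T) \<longleftrightarrow>
    pverts T \<noteq> {} \<and> (\<forall>u\<in>pverts T. \<forall>v\<in>pverts T. (u, v) \<in> (parcs T)\<^sup>*)"
proof -
  interpret pair_graph T by fact
  have "mk_symmetric (with_proj T) = T"
    by (cases T) (use arcs_symmetric in \<open>force simp: mk_symmetric_def\<close>)
  then show ?thesis
    by (auto simp: connected_def strongly_connected_def reachable_conv)
qed

text \<open>Every arc contains the centre \<open>c\<close>. Among three consecutive arcs
  \<open>(u, x)\<close>, \<open>(x, y)\<close>, \<open>(y, z)\<close> of a cycle, the last misses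
  \<open>c\<close> if \<open>x = c\<close>, and the first misses it if \<open>y = c\<close>.\<close>

lemma is_star_imp_is_tree:
  assumes "is_star T"
  shows "is_tree T"
proof -
  from assms obtain c where T: "pair_graph T" and c: "c \<in> pverts T"
    and arcs: "parcs T = {c} \<times> (pverts T - {c}) \<union> (pverts T - {c}) \<times> {c}"
    by (auto simp: is_star_def)
  interpret pair_graph T by fact
  have "(u, c) \<in> (parcs T)\<^sup>*" "(c, u) \<in> (parcs T)\<^sup>*" if "u \<in> pverts T" for u
    using that c arcs by (cases "u = c"; auto)+
  then have "Digraph_Component.connected (with_proj T)"
    unfolding connected_pair_graph_iff[OF T] using c by (blast intro: rtrancl_trans)
  moreover have "\<not> (cycle p \<and> 3 \<le> length p)" for p
  proof
    assume "cycle p \<and> 3 \<le> length p"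
    then obtain u where p: "awalk u p u" "distinct (tl (awalk_verts u p))" "3 \<le> length p"
      by (auto simp: cycle_def)
    then obtain e1 e2 e3 q where q: "p = e1 # e2 # e3 # q"
      by (auto simp: numeral_3_eq_3 Suc_le_length_iff)
    obtain x y z where e: "e1 = (u, x)" "e2 = (x, y)" "e3 = (y, z)" 
      using p(1) unfolding q by (cases e1; cases e2; cases e3) (auto simp: awalk_simps)
    have E: "(u, x) \<in> parcs T" "(x, y) \<in> parcs T" "(y, z) \<in> parcs T" and qw: "awalk z q u"
      using p(1) unfolding q e by (auto simp: awalk_simps)
    have d: "distinct (x # y # awalk_verts z q)"
      using p(2) unfolding q e by simp
    \<comment> \<open>\<open>d\<close> concerns the vertices after the start only; \<open>u\<close>
      is among them because the closed walk ends in \<open>u\<close>.\<close>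
    have "u \<in> set (awalk_verts z q)" "z \<in> set (awalk_verts z q)"
      using set_awalk_verts_cas[of z q u] hd_in_awalk_verts(1)[OF qw] qw awlast_of_awalk[OF qw]
        last_in_set[OF awalk_verts_non_Nil, of z q] by auto
    then have "x \<noteq> y" "x \<noteq> z" "y \<noteq> z" "y \<noteq> u" "x \<noteq> u" using d by auto
    with E arcs show False by auto
  qed
  ultimately show ?thesis
    unfolding is_tree_def using T by blast
qed

text \<open>A path from \<open>y\<close> to \<open>x\<close> that avoids the edge closes up with it
  to a cycle. The path has at least two arcs: \<open>x \<noteq> y\<close>, and its only possible
  single arc \<open>(y, x)\<close> is excluded.\<close>

lemma tree_no_detour:
  assumes T: "is_tree T" and xy: "(x, y) \<in> parcs T"
  shows "(y, x) \<notin> (parcs T - {(x, y), (y, x)})\<^sup>*"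
proof
  assume detour: "(y, x) \<in> (parcs T - {(x, y), (y, x)})\<^sup>*"
  interpret T: pair_graph T using T by (simp add: is_tree_def)
  define T' where "T' = \<lparr>pverts = pverts T, parcs = parcs T - {(x, y), (y, x)}\<rparr>"
  interpret T': pair_wf_digraph T'
    by unfold_locales (auto simp: T'_def dest: T.in_arcsD1 T.in_arcsD2)
  have ne: "x \<noteq> y" using T.no_loops' xy by blast
  have "y \<rightarrow>\<^sup>*\<^bsub>with_proj T'\<^esub> x"
    using detour T.in_arcsD1[OF xy] T.in_arcsD2[OF xy] unfolding T'.reachable_conv by (simp add: T'_def)
  then obtain p where p: "T'.apath y p x" using T'.reachable_apath by blast
  have awalk: "T'.awalk y p x" and dist: "distinct (pawalk_verts y p)"
    using p by (simp_all add: T'.apath_def)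
  have arcs: "set p \<subseteq> parcs T - {(x, y), (y, x)}"
    using awalk unfolding T'.awalk_def by (simp add: T'_def)
  then have "T.awalk y p x"
    using awalk T.in_arcsD2[OF xy] by (auto simp: T'.awalk_def T.awalk_def)
  then have cyc: "T.cycle ((x, y) # p)"
    using dist xy T.in_arcsD1[OF xy] by (auto simp: T.cycle_def T.awalk_simps)
  have "p \<noteq> []" using awalk ne by (auto simp: T'.awalk_Nil_iff)
  moreover have "p \<noteq> [e]" for e
    using awalk arcs by (cases e) (auto simp: T'.awalk_simps)
  ultimately have "3 \<le> length ((x, y) # p)"
    by (cases p; cases "tl p") auto
  with cyc T show False unfolding is_tree_def by blast
qed

text \<open>
  If no part is a balanced separator, choose for every node \<open>x\<close> a heavy component of \<open>G - P x\<close>, and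
  let \<open>D x\<close> be the component of \<open>T - x\<close> containing its indices. Any two heavy components meet,
  hence so do any two of the \<open>D x\<close>. For \<open>x\<close> with \<open>D x\<close> smallest and \<open>y\<close> its neighbour in
  \<open>D x\<close>, acyclicity forces \<open>D y \<subset> D x\<close>.
\<close>

lemma tree_partition_balanced_separator:
  assumes T: "is_tree T" and G: "pair_graph G" and part: "graph_partition T G P"
  shows "\<exists>x\<in>pverts T. balanced_separator G (P x)"
proof (rule ccontr)
  assume none: "\<not> ?thesis"
  interpret T: pair_graph T using T by (simp add: is_tree_def)
  have ne: "pverts T \<noteq> {}"
    and conn: "\<And>u v. \<lbrakk>u \<in> pverts T; v \<in> pverts T\<rbrakk> \<Longrightarrow> (u, v) \<in> (parcs T)\<^sup>*"
    using T connected_pair_graph_iff[of T] unfolding is_tree_def by blast+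
  have cover: "(\<Union>x\<in>pverts T. P x) = pverts G"
    and disj: "disjoint_family_on P (pverts T)"
    and arc: "\<And>v w x y. \<lbrakk>(v, w) \<in> parcs G; x \<in> pverts T; y \<in> pverts T; v \<in> P x; w \<in> P y\<rbrakk>
      \<Longrightarrow> x = y \<or> (x, y) \<in> parcs T"
    using part unfolding graph_partition_def by blast+
  define G' where "G' x = pinduce G (pverts G - P x)" for x
  have "\<forall>x\<in>pverts T. \<exists>C\<in>components (G' x). card C > card (pverts G) / 2"
    using none cover unfolding balanced_separator_iff G'_def by (fastforce simp: not_le)
  then obtain C where C: "\<And>x. x \<in> pverts T \<Longrightarrow> C x \<in> components (G' x)"
    and heavy: "\<And>x. x \<in> pverts T \<Longrightarrow> card (C x) > card (pverts G) / 2"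
    by metis
  have G': "pair_graph (G' x)" for x
    using G by (simp add: G'_def pair_graph_pinduce)
  have C_sub: "C x \<subseteq> pverts G - P x" "C x \<noteq> {}" if "x \<in> pverts T" for x
    using partition_on_components[OF G', of x] C[OF that]
    by (auto simp: partition_on_def G'_def)
  have meet: "C x \<inter> C y \<noteq> {}" if "x \<in> pverts T" "y \<in> pverts T" for x y
  proof
    assume "C x \<inter> C y = {}"
    moreover have fin: "finite (pverts G)" using G by (simp add: pair_graph_iff)
    moreover have "finite (C x)" "finite (C y)"
      using C_sub that fin by (meson finite_Diff finite_subset)+
    ultimately have "card (C x) + card (C y) \<le> card (pverts G)"
      using C_sub that by (subst card_Un_disjoint[symmetric]) (auto intro!: card_mono)
    with heavy[OF that(1)] heavy[OF that(2)] show False by linarith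
  qed
  obtain ix where ix: "\<And>v. v \<in> pverts G \<Longrightarrow> ix v \<in> pverts T \<and> v \<in> P (ix v)"
    using cover by (metis UN_E)
  \<comment> \<open>The arcs of \<open>T - x\<close>. Reachability along them describes the
    components of \<open>T - x\<close> without forming that graph.\<close>
  define E where "E x = {(a, b) \<in> parcs T. a \<noteq> x \<and> b \<noteq> x}" for x
  have symE: "(b, a) \<in> (E x)\<^sup>*" if "(a, b) \<in> (E x)\<^sup>*" for a b x
  proof -
    have "sym (E x)" by (auto simp: sym_def E_def intro: T.arcs_symmetric)
    then show ?thesis using that by (meson sym_rtrancl symD)
  qed
  \<comment> \<open>\<open>ix\<close> maps a walk in \<open>G - P x\<close> to a walk in
    \<open>T - x\<close>, possibly with repeated nodes.\<close>
  have C_conn: "(ix u, ix v) \<in> (E x)\<^sup>*" if x: "x \<in> pverts T" and "u \<in> C x" "v \<in> C x" for u v x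
  proof -
    interpret G'x: pair_graph "G' x" by (rule G')
    have "u \<rightarrow>\<^sup>*\<^bsub>with_proj (G' x)\<^esub> v"
      using C[OF x] that unfolding G'x.in_sccs_verts_conv_reachable by blast
    then show ?thesis
    proof (induction rule: G'x.reachable_induct)
      case base
      show ?case by simp
    next
      case (step v w)
      then have "(v, w) \<in> parcs G" "v \<in> pverts G - P x" "w \<in> pverts G - P x"
        by (auto simp: G'_def)
      moreover from this have "ix v = ix w \<or> (ix v, ix w) \<in> parcs T"
        using arc ix by (meson DiffD1)
      ultimately have "ix v = ix w \<or> (ix v, ix w) \<in> E x"
        using ix by (auto simp: E_def)
      with step.IH show ?case by auto
    qed
  qed
  define a where "a x = ix (SOME v. v \<in> C x)" for x
  define D where "D x = (E x)\<^sup>* `` {a x}" for x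
  have some: "(SOME v. v \<in> C x) \<in> C x" if "x \<in> pverts T" for x
    using C_sub(2)[OF that] some_in_eq by blast
  have a: "a x \<in> pverts T" "a x \<noteq> x" if "x \<in> pverts T" for x
    using some[OF that] C_sub(1)[OF that] ix unfolding a_def by (metis DiffD1 DiffD2 subsetD)+
  have D_sub: "D x \<subseteq> pverts T - {x}" if "x \<in> pverts T" for x
  proof
    fix w assume "w \<in> D x"
    then have "(a x, w) \<in> (E x)\<^sup>*" by (simp add: D_def)
    then show "w \<in> pverts T - {x}"
      using a[OF that] by (induction) (auto simp: E_def dest: T.in_arcsD2)
  qed
  have D_meet: "D x \<inter> D y \<noteq> {}" if xy: "x \<in> pverts T" "y \<in> pverts T" for x y
  proof -
    obtain v where v: "v \<in> C x" "v \<in> C y" using meet[OF xy] by blast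
    have "ix v \<in> D x" "ix v \<in> D y"
      using C_conn[OF xy(1) some[OF xy(1)] v(1)] C_conn[OF xy(2) some[OF xy(2)] v(2)]
      by (simp_all add: D_def a_def)
    then show ?thesis by blast
  qed
  have neighbour: "\<exists>y\<in>D x. (y, x) \<in> parcs T" if x: "x \<in> pverts T" for x
  proof -
    \<comment> \<open>Invariant along a walk from \<open>a x\<close> to \<open>x\<close>: it is
      still inside \<open>D x\<close>, or it has already stepped from \<open>D x\<close> to
      \<open>x\<close>.\<close>
    have "(w \<noteq> x \<and> w \<in> D x) \<or> (\<exists>y\<in>D x. (y, x) \<in> parcs T)" if "(a x, w) \<in> (parcs T)\<^sup>*" for w
      using that
    proof induction
      case base
      show ?case using a[OF x] by (auto simp: D_def)
    next
      case (step w w')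
      then show ?case
        by (cases "w' = x") (auto simp: D_def E_def intro: rtrancl_into_rtrancl)
    qed
    from this[OF conn[OF a(1)[OF x] x]] show ?thesis by blast
  qed
  obtain x where x: "x \<in> pverts T" and min: "\<And>y. y \<in> pverts T \<Longrightarrow> card (D x) \<le> card (D y)"
    using ne ex_has_least_nat[of "\<lambda>x. x \<in> pverts T" _ "\<lambda>x. card (D x)"] by blast
  obtain y where y: "y \<in> D x" "(y, x) \<in> parcs T" using neighbour[OF x] by blast
  have yT: "y \<in> pverts T" using D_sub[OF x] y by blast
  obtain z where z: "z \<in> D x" "z \<in> D y" using D_meet[OF x yT] by blast
  \<comment> \<open>Otherwise \<open>y\<close> reaches \<open>z\<close> avoiding \<open>x\<close>,
    and \<open>z\<close> reaches \<open>x\<close> avoiding \<open>y\<close>. Neither walk uses the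
    edge between \<open>x\<close> and \<open>y\<close>, so together they form a detour.\<close>
  have xD: "x \<notin> D y"
  proof
    assume "x \<in> D y"
    then have "(z, x) \<in> (E y)\<^sup>*"
      using z(2) symE unfolding D_def by (meson Image_singleton_iff rtrancl_trans)
    moreover have "(y, z) \<in> (E x)\<^sup>*"
      using z(1) y(1) symE unfolding D_def by (meson Image_singleton_iff rtrancl_trans)
    moreover have "E x \<subseteq> parcs T - {(x, y), (y, x)}" "E y \<subseteq> parcs T - {(x, y), (y, x)}"
      by (auto simp: E_def)
    ultimately have "(y, x) \<in> (parcs T - {(x, y), (y, x)})\<^sup>*"
      by (meson rtrancl_mono rtrancl_trans subsetD)
    with tree_no_detour[OF T T.arcs_symmetric[OF y(2)]] show False by blast
  qed
  \<comment> \<open>A walk from \<open>z\<close> along \<open>E y\<close> stays in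
    \<open>D y\<close>, which misses \<open>x\<close>; hence its arcs also belong to
    \<open>E x\<close>.\<close>
  have "D y \<subseteq> D x"
  proof
    fix w assume "w \<in> D y"
    then have "(z, w) \<in> (E y)\<^sup>*"
      using z(2) symE unfolding D_def by (meson Image_singleton_iff rtrancl_trans)
    then have "w \<in> D x \<and> w \<in> D y"
    proof induction
      case base
      show ?case using z by blast
    next
      case (step w w')
      then have "w' \<in> D y" by (auto simp: D_def intro: rtrancl_into_rtrancl)
      with step xD have "(w, w') \<in> E x" by (auto simp: E_def)
      with step \<open>w' \<in> D y\<close> show ?case by (auto simp: D_def intro: rtrancl_into_rtrancl)
    qed
    then show "w \<in> D x" by simp
  qed
  moreover have "y \<notin> D y" using D_sub[OF yT] by blast
  moreover have "finite (D x)"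
    using D_sub[OF x] T.pair_finite_verts by (meson finite_Diff finite_subset)
  ultimately have "card (D y) < card (D x)"
    using y(1) by (intro psubset_card_mono) auto
  with min[OF yT] show False by simp
qed

section \<open>Pointwise comparison of the three parameters\<close>

lemma tree_partition_width_le_star_partition_width:
  assumes "pair_graph G"
  shows "tree_partition_width G \<le> star_partition_width G"
proof -
  have "\<exists>(H :: nat pair_pre_digraph) P.
      is_star H \<and> graph_partition H G P \<and> partition_width H P = star_partition_width G"
    unfolding star_partition_width_def
    by (rule LeastI_ex) (use star_partition_width_le_card(2)[OF assms] in blast)
  then show ?thesis
    unfolding tree_partition_width_def using is_star_imp_is_tree by (intro Least_le) blast
qed

lemma separation_number_le_tree_partition_width:
  assumes "pair_graph G"
  shows "separation_number G \<le> tree_partition_width G"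
proof -
  have "\<exists>(H :: nat pair_pre_digraph) P.
      is_tree H \<and> graph_partition H G P \<and> partition_width H P = tree_partition_width G"
    unfolding tree_partition_width_def
    by (rule LeastI_ex) (use star_partition_width_le_card(2)[OF assms] is_star_imp_is_tree in blast)
  then obtain H :: "nat pair_pre_digraph" and P where H: "is_tree H" "graph_partition H G P"
    and w: "partition_width H P = tree_partition_width G" by blast
  obtain x where x: "x \<in> pverts H" "balanced_separator G (P x)"
    using tree_partition_balanced_separator[OF H(1) assms H(2)] by blast
  have "finite (pverts H)" using H(1) by (simp add: is_tree_def pair_graph_iff)
  then have "card (P x) \<le> partition_width H P"
    unfolding partition_width_def using x by (intro Max_ge) auto
  with separation_number_le[OF x(2)] w show ?thesis by simp
qed

section \<open>Strongly sublinear separators yield small fragments\<close>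

text \<open>
  Separate recursively until all parts have at most \<open>p\<close> vertices. Spreading the cost of each
  separation over the vertices of the current part, a vertex in a part of size \<open>n\<close> pays
  \<open>c n\<^sup>-\<^sup>\<epsilon>\<close>; as sizes at least halve, its total payment is a geometric series dominated by
  the last term, which is at most \<open>c p\<^sup>-\<^sup>\<epsilon>\<close>. The function \<open>h\<close> is that total.
\<close>

lemma ex_fragmentation:
  fixes c \<epsilon> p :: real
  assumes pg: "\<And>G. G \<in> \<G> \<Longrightarrow> pair_graph G" and her: "hereditary \<G>"
    and \<epsilon>: "0 < \<epsilon>" and c: "0 \<le> c" and p: "0 < p"
    and sep: "\<And>G. \<lbrakk>G \<in> \<G>; pverts G \<noteq> {}\<rbrakk> \<Longrightarrow>
      separation_number G \<le> c * card (pverts G) powr (1 - \<epsilon>)"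
    and "G \<in> \<G>"
  defines "b \<equiv> c / (2 powr \<epsilon> - 1)"
  shows "\<exists>S \<P>. fragmentation G S \<P> \<and> (\<forall>X\<in>\<P>. card X \<le> p) \<and>
    card S \<le> card (pverts G) * (b * 2 powr \<epsilon> * p powr - \<epsilon>)"
proof -
  have two: "2 powr \<epsilon> > 1" using \<epsilon> by simp
  \<comment> \<open>\<open>b * 2 powr \<epsilon>\<close> is the sum of the geometric series with
    first term \<open>c\<close> and ratio \<open>2 powr - \<epsilon>\<close>; dropping the first
    term leaves \<open>b\<close>.\<close>
  have "b * (2 powr \<epsilon> - 1) = c" using \<epsilon> by (simp add: b_def)
  moreover have "0 \<le> b" using c two by (simp add: b_def)
  ultimately have b: "0 \<le> b" "b * 2 powr \<epsilon> = b + c"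
    by (simp_all add: right_diff_distrib)
  \<comment> \<open>The payments at sizes \<open>p\<close>, \<open>2 * p\<close>,
    \<open>4 * p\<close> and so on, minus those at \<open>2 * t\<close>, \<open>4 * t\<close> and so
    on. The maximum keeps \<open>h\<close> nonnegative at sizes below \<open>p / 2\<close>.\<close>
  define h where "h t = max 0 (b * 2 powr \<epsilon> * p powr - \<epsilon> - b * t powr - \<epsilon>)" for t :: real
  have h_mono: "h s \<le> h t" if "0 < s" "s \<le> t" for s t
  proof -
    have "t powr - \<epsilon> \<le> s powr - \<epsilon>" using that \<epsilon> by (intro powr_mono2') auto
    then show ?thesis unfolding h_def using b(1) by (intro max.mono diff_left_mono mult_left_mono) auto
  qed
  have h_step: "c * t powr - \<epsilon> + h (t / 2) \<le> h t" if "p \<le> t" for t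
  proof -
    have "(t / 2) powr - \<epsilon> = 2 powr \<epsilon> * t powr - \<epsilon>"
      using that p by (simp add: powr_divide powr_minus field_simps)
    then have half: "b * (t / 2) powr - \<epsilon> = (b + c) * t powr - \<epsilon>"
      using b(2) by (metis mult.assoc)
    \<comment> \<open>For \<open>t \<ge> p\<close> the maximum in \<open>h (t / 2)\<close> therefore
      does not truncate, and adding \<open>c * t powr - \<epsilon>\<close> gives exactly the
      untruncated value of \<open>h t\<close>.\<close>
    have "(b + c) * t powr - \<epsilon> \<le> (b + c) * p powr - \<epsilon>"
      using that p \<epsilon> b c by (intro mult_left_mono powr_mono2') auto
    then show ?thesis unfolding h_def half b(2) by (auto simp: max_def algebra_simps)
  qed
  have h_le: "h t \<le> b * 2 powr \<epsilon> * p powr - \<epsilon>" for t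
    unfolding h_def using b(1) by auto
  \<comment> \<open>The induction uses \<open>h\<close> at the current size: a bound per vertex
    independent of the size would leave no room for the cost of the next separator.\<close>
  have "\<exists>S \<P>. fragmentation G S \<P> \<and> (\<forall>X\<in>\<P>. card X \<le> p) \<and>
    card S \<le> card (pverts G) * h (card (pverts G))" using \<open>G \<in> \<G>\<close>
  proof (induction "card (pverts G)" arbitrary: G rule: less_induct)
    case less
    let ?n = "card (pverts G)"
    have G: "pair_graph G" using pg less.prems .
    then have fin: "finite (pverts G)" by (simp add: pair_graph_iff)
    show ?case
    proof (cases "?n \<le> p")
      case True
      \<comment> \<open>Removing \<open>{}\<close> covers the graph without vertices, as a partition
        has no empty part.\<close>
      have "fragmentation G {} ({pverts G} - {{}})"
        using G by (auto simp: fragmentation_def partition_on_def disjoint_def pair_graph_iff)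
      moreover have "0 \<le> ?n * h ?n" by (simp add: h_def)
      ultimately show ?thesis using True
        by (intro exI[of _ "{}"] exI[of _ "{pverts G} - {{}}"]) auto
    next
      case False
      then have n: "0 < ?n" "p \<le> ?n" using p by auto
      then have V: "pverts G \<noteq> {}" by auto
      obtain S where S: "balanced_separator G S" "card S = separation_number G"
        using separation_number_attained[OF G] .
      define \<C> where "\<C> = components (pinduce G (pverts G - S))"
      have SV: "S \<subseteq> pverts G" using S(1) by (simp add: balanced_separator_iff)
      have half: "card X \<le> ?n / 2" if "X \<in> \<C>" for X
        using S(1) that by (simp add: balanced_separator_iff \<C>_def)
      have frag: "fragmentation G S \<C>"
        unfolding \<C>_def using G SV by (rule fragmentation_components)
      note finC = fragmentation_finite[OF G frag]
      have CV: "X \<subseteq> pverts G" "X \<noteq> {}" if "X \<in> \<C>" for X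
        using frag that by (auto simp: fragmentation_def partition_on_def)
      have "\<exists>T \<Q>. fragmentation (pinduce G X) T \<Q> \<and> (\<forall>Y\<in>\<Q>. card Y \<le> p) \<and>
          card T \<le> card X * h (card X)" if "X \<in> \<C>" for X
        using less.hyps[of "pinduce G X"] half[OF that] n(1)
          hereditary_pinduce[OF her less.prems G CV(1)[OF that]] by auto
      then obtain T \<Q> where TQ: "\<And>X. X \<in> \<C> \<Longrightarrow> fragmentation (pinduce G X) (T X) (\<Q> X)"
        and Q: "\<And>X Y. \<lbrakk>X \<in> \<C>; Y \<in> \<Q> X\<rbrakk> \<Longrightarrow> card Y \<le> p"
        and cT: "\<And>X. X \<in> \<C> \<Longrightarrow> card (T X) \<le> card X * h (card X)"
        by metis
      let ?S = "S \<union> (\<Union>X\<in>\<C>. T X)"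
      have "(\<Sum>X\<in>\<C>. card X) = card (pverts G - S)"
        using frag finC card_Union_disjoint[of \<C>]
        by (auto simp: fragmentation_def partition_on_def)
      also have "\<dots> \<le> ?n" using fin by (intro card_mono) auto
      finally have sum: "(\<Sum>X\<in>\<C>. real (card X)) \<le> ?n"
        by (metis of_nat_le_iff of_nat_sum)
      have "real (card ?S) \<le> card S + (\<Sum>X\<in>\<C>. real (card (T X)))"
      proof -
        have "card ?S \<le> card S + card (\<Union>X\<in>\<C>. T X)" by (rule card_Un_le)
        also have "\<dots> \<le> card S + (\<Sum>X\<in>\<C>. card (T X))"
          using card_UN_le[OF finC(1)] by simp
        finally show ?thesis by (simp flip: of_nat_sum of_nat_add)
      qed
      also have "(\<Sum>X\<in>\<C>. real (card (T X))) \<le> (\<Sum>X\<in>\<C>. card X * h (?n / 2))"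
      proof (rule sum_mono)
        fix X assume X: "X \<in> \<C>"
        then have "0 < card X" using CV finC by (simp add: card_gt_0_iff)
        then have "h (card X) \<le> h (?n / 2)" using half[OF X] by (intro h_mono) auto
        with cT[OF X] show "card (T X) \<le> card X * h (?n / 2)"
          by (meson mult_left_mono of_nat_0_le_iff order_trans)
      qed
      also have "\<dots> \<le> ?n * h (?n / 2)"
        using sum by (simp add: h_def mult_right_mono flip: sum_distrib_right)
      \<comment> \<open>The separator bound \<open>c * ?n powr (1 - \<epsilon>)\<close>, charged
        evenly to the \<open>?n\<close> vertices.\<close>
      also have "real (card S) \<le> ?n * (c * ?n powr - \<epsilon>)"
        using sep[OF less.prems V] S(2) n by (simp add: powr_diff powr_minus field_simps)
      also have "?n * (c * ?n powr - \<epsilon>) + ?n * h (?n / 2) \<le> ?n * h ?n"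
        unfolding distrib_left[symmetric] using h_step[OF n(2)] by (intro mult_left_mono) auto
      finally have "card ?S \<le> ?n * h ?n" by simp
      moreover have "fragmentation G ?S (\<Union>X\<in>\<C>. \<Q> X)"
        using frag TQ by (rule fragmentation_refine)
      ultimately show ?thesis using Q by blast
    qed
  qed
  then show ?thesis using h_le by (meson mult_left_mono of_nat_0_le_iff order_trans)
qed

section \<open>Strong sublinearity\<close>

text \<open>The bound by the number of vertices makes the set bounded above, so that its
  \<open>Sup\<close> is an upper bound.\<close>

lemma class_parameter_upper:
  assumes "\<And>G. G \<in> \<G> \<Longrightarrow> f G \<le> card (pverts G)" "G \<in> \<G>"
  shows "f G \<le> class_parameter f \<G> (card (pverts G))"
  unfolding class_parameter_def
proof (rule cSup_upper)
  have "x \<le> card (pverts G)" if "x \<in> {f H | H. H \<in> \<G> \<and> card (pverts H) = card (pverts G)}" for x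
    using that assms(1) by force
  then show "bdd_above {f H | H. H \<in> \<G> \<and> card (pverts H) = card (pverts G)}"
    by (rule bdd_aboveI)
qed (use assms(2) in blast)

text \<open>\<open>0 \<le> B\<close> handles the sizes that no graph of the class has, where
  \<open>Sup {} = 0\<close>.\<close>

lemma class_parameter_least:
  assumes "\<And>G. \<lbrakk>G \<in> \<G>; card (pverts G) = n\<rbrakk> \<Longrightarrow> real (f G) \<le> B" "0 \<le> B"
  shows "real (class_parameter f \<G> n) \<le> B"
proof (cases "{f G | G. G \<in> \<G> \<and> card (pverts G) = n} = {}")
  case True
  then show ?thesis using assms(2) by (simp add: class_parameter_def Sup_nat_def)
next
  case False
  then have "class_parameter f \<G> n \<le> nat \<lfloor>B\<rfloor>"
    unfolding class_parameter_def
    by (intro cSup_least) (use assms in \<open>auto simp: le_nat_floor\<close>)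
  then show ?thesis using assms(2) by linarith
qed

lemma strongly_sublinear_mono:
  assumes fg: "\<And>G. G \<in> \<G> \<Longrightarrow> f G \<le> g G" and g: "\<And>G. G \<in> \<G> \<Longrightarrow> g G \<le> card (pverts G)"
    and "strongly_sublinear g \<G>"
  shows "strongly_sublinear f \<G>"
proof -
  have "real (class_parameter f \<G> n) \<le> real (class_parameter g \<G> n)" for n
    using class_parameter_upper[of \<G> g, OF g] fg
    by (intro class_parameter_least) (auto intro: order_trans)
  then have "(\<lambda>n. real (class_parameter f \<G> n)) \<in> O(\<lambda>n. real (class_parameter g \<G> n))"
    by (intro bigoI[of _ 1]) (auto intro!: always_eventually)
  with assms(3) show ?thesis
    unfolding strongly_sublinear_def using landau_o.big_trans by blast
qed

text \<open>Turns the asymptotic bound into one for every nonempty graph of the class: the constant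
  is raised to \<open>N\<close>, which covers the sizes below \<open>N\<close> since
  \<open>f G\<close> is at most the size.\<close>

lemma strongly_sublinearD:
  assumes "strongly_sublinear f \<G>" and f: "\<And>G. G \<in> \<G> \<Longrightarrow> f G \<le> card (pverts G)"
  obtains \<epsilon> c :: real where "0 < \<epsilon>" "0 \<le> c"
    "\<And>G. \<lbrakk>G \<in> \<G>; card (pverts G) > 0\<rbrakk> \<Longrightarrow> f G \<le> c * card (pverts G) powr (1 - \<epsilon>)"
proof -
  from assms(1) obtain \<delta> where \<delta>: "0 < \<delta>"
    and O: "(\<lambda>n. real (class_parameter f \<G> n)) \<in> O(\<lambda>n. real n powr (1 - \<delta>))"
    by (auto simp: strongly_sublinear_def)
  from landau_o.bigE[OF O] obtain d where d: "0 < d"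
    and ev: "eventually (\<lambda>n. real (class_parameter f \<G> n) \<le> d * real n powr (1 - \<delta>)) sequentially"
    by auto
  then obtain N where N: "\<And>n. n \<ge> N \<Longrightarrow> real (class_parameter f \<G> n) \<le> d * real n powr (1 - \<delta>)"
    by (auto simp: eventually_sequentially)
  \<comment> \<open>Capping at 1 keeps the exponent \<open>1 - \<epsilon>\<close> nonnegative, so
    the power is at least 1 for every positive size.\<close>
  define \<epsilon> where "\<epsilon> = min \<delta> 1"
  show thesis
  proof (rule that)
    show "0 < \<epsilon>" "0 \<le> max d N" using \<delta> d by (auto simp: \<epsilon>_def)
    fix G assume G: "G \<in> \<G>" "card (pverts G) > 0"
    let ?n = "card (pverts G)"
    show "f G \<le> max d N * ?n powr (1 - \<epsilon>)"
    proof (cases "?n \<ge> N")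
      case True
      have "real (f G) \<le> class_parameter f \<G> ?n"
        using class_parameter_upper[of \<G> f, OF f G(1)] by simp
      also have "\<dots> \<le> d * ?n powr (1 - \<delta>)" using N[OF True] .
      also have "\<dots> \<le> max d N * ?n powr (1 - \<epsilon>)"
        using G d by (intro mult_mono powr_mono) (auto simp: \<epsilon>_def)
      finally show ?thesis .
    next
      case False
      have "f G \<le> max d N" using f[OF G(1)] False by linarith
      moreover have "1 \<le> ?n powr (1 - \<epsilon>)" using G by (intro ge_one_powr_ge_zero) (auto simp: \<epsilon>_def)
      ultimately show ?thesis using d by (smt (verit) mult_le_cancel_left1)
    qed
  qed
qed

lemma strongly_sublinear_separation_imp_star:
  assumes pg: "\<And>G. G \<in> \<G> \<Longrightarrow> pair_graph G" and her: "hereditary \<G>"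
    and sub: "strongly_sublinear separation_number \<G>"
  shows "strongly_sublinear star_partition_width \<G>"
proof -
  have "separation_number G \<le> card (pverts G)" if "G \<in> \<G>" for G
    using separation_number_le_tree_partition_width tree_partition_width_le_star_partition_width
      star_partition_width_le_card(1) pg[OF that] by (meson order_trans)
  from strongly_sublinearD[OF sub this] obtain \<epsilon> c :: real where \<epsilon>: "0 < \<epsilon>" and c: "0 \<le> c"
    and sep: "\<And>G. \<lbrakk>G \<in> \<G>; card (pverts G) > 0\<rbrakk> \<Longrightarrow>
      separation_number G \<le> c * card (pverts G) powr (1 - \<epsilon>)"
    by blast
  define A where "A = c / (2 powr \<epsilon> - 1) * 2 powr \<epsilon>"
  have "1 < 2 powr \<epsilon>" using \<epsilon> by simp
  then have A: "0 \<le> A" using c by (simp add: A_def)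
  \<comment> \<open>Then \<open>1 - \<delta> = 1 / (1 + \<epsilon>)\<close>, the exponent for which
    \<open>p = n powr (1 - \<delta>)\<close> solves
    \<open>n * p powr - \<epsilon> = p\<close>.\<close>
  define \<delta> where "\<delta> = \<epsilon> / (1 + \<epsilon>)"
  have \<delta>: "0 < \<delta>" using \<epsilon> by (simp add: \<delta>_def)
  have spw: "real (star_partition_width G) \<le> (A + 1) * n powr (1 - \<delta>)"
    if G: "G \<in> \<G>" and n: "card (pverts G) = n" "0 < n" for G n
  proof -
    define p where "p = n powr (1 - \<delta>)"
    have p: "0 < p" using n by (simp add: p_def)
    have "1 + (1 - \<delta>) * - \<epsilon> = 1 - \<delta>" using \<epsilon> by (simp add: \<delta>_def field_simps)
    then have np: "n * p powr - \<epsilon> = p"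
      unfolding p_def powr_powr using n by (metis of_nat_0_less_iff powr_mult_base less_imp_le)
    have "separation_number G \<le> c * card (pverts G) powr (1 - \<epsilon>)"
      if "G \<in> \<G>" "pverts G \<noteq> {}" for G
      using sep[OF that(1)] pg[OF that(1)] that(2) by (simp add: pair_graph_iff card_gt_0_iff)
    from ex_fragmentation[OF pg her \<epsilon> c p this G]
    obtain S \<P> where frag: "fragmentation G S \<P>" and P: "\<And>X. X \<in> \<P> \<Longrightarrow> card X \<le> p"
      and S: "card S \<le> n * (A * p powr - \<epsilon>)"
      unfolding A_def n(1) by blast
    have "n * (A * p powr - \<epsilon>) = A * p" using np by (metis mult.left_commute)
    \<comment> \<open>The centre has at most \<open>A * p\<close> vertices and each leaf at most
      \<open>p\<close>; the factor \<open>A + 1\<close> covers both.\<close>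
    then have S': "card S \<le> (A + 1) * p" using S p unfolding distrib_right by linarith
    have P': "card X \<le> (A + 1) * p" if "X \<in> \<P>" for X
      using P[OF that] mult_nonneg_nonneg[OF A less_imp_le[OF p]] unfolding distrib_right by linarith
    have "star_partition_width G \<le> nat \<lfloor>(A + 1) * p\<rfloor>"
      using pg[OF G] frag le_nat_floor[OF S'] le_nat_floor[OF P']
      by (rule star_partition_width_le)
    then have "star_partition_width G \<le> (A + 1) * p"
      using A p by (smt (verit) mult_nonneg_nonneg of_nat_floor of_nat_mono)
    then show ?thesis by (simp add: p_def)
  qed
  have "(\<lambda>n. real (class_parameter star_partition_width \<G> n)) \<in> O(\<lambda>n. real n powr (1 - \<delta>))"
  proof (rule bigoI)
    show "\<forall>\<^sub>F n in sequentially. norm (real (class_parameter star_partition_width \<G> n))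
        \<le> (A + 1) * norm (real n powr (1 - \<delta>))"
      using eventually_gt_at_top[of 0]
    proof eventually_elim
      case (elim n)
      then show ?case using class_parameter_least[OF spw[of _ n]] A by simp
    qed
  qed
  with \<delta> show ?thesis unfolding strongly_sublinear_def by blast
qed

theorem theorem3:
  fixes \<G> :: "'a pair_pre_digraph set"
  assumes "\<forall>G\<in>\<G>. pair_graph G"
    and "hereditary \<G>"
  shows "(strongly_sublinear separation_number \<G> \<longleftrightarrow> strongly_sublinear tree_partition_width \<G>) \<and>
         (strongly_sublinear tree_partition_width \<G> \<longleftrightarrow> strongly_sublinear star_partition_width \<G>)"
proof -
  have 1: "separation_number G \<le> tree_partition_width G"
    and 2: "tree_partition_width G \<le> star_partition_width G"
    and 3: "star_partition_width G \<le> card (pverts G)" if "G \<in> \<G>" for G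
    using assms(1) that separation_number_le_tree_partition_width
      tree_partition_width_le_star_partition_width star_partition_width_le_card(1) by blast+
  have 4: "tree_partition_width G \<le> card (pverts G)" if "G \<in> \<G>" for G
    using 2[OF that] 3[OF that] by simp
  \<comment> \<open>The pointwise inequalities pass sublinearity from star to tree to separator, and
    the recursive separation closes the cycle.\<close>
  show ?thesis
    using strongly_sublinear_mono[of \<G>, OF 1 4] strongly_sublinear_mono[of \<G>, OF 2 3]
      strongly_sublinear_separation_imp_star[of \<G>] assms by blast
qed

end
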